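(* Let $m,k\in\mathbb N_0$. In each sum below, the index $i$ runs only over values with $m+i$ even. (1) If $0\leq k\leq m$, then $$\sum_{\substack{i=0\\ m+i~\text{even}}}^{m}\binom mi\binom{m+i}{k}\binom{m+i-k}{m-k}E_i(0)=(-1)^m\binom{m}{k}.$$ (2) If $0\leq k\leq m-1$, then $$\sum_{\substack{i=0\\ m+i~\text{even}}}^{m}\binom mi\binom{m+i}{k}\binom{m+i-k}{m-k-1}E_{i+1}(0)=0.$$ (3) If $l\in\mathbb N_0$ with $0\leq l\leq m-k-1$, then $$\sum_{\substack{i=0\\ m+i~\text{even}}}^{m}\binom mi\binom{m+i}{k}\binom{m+i-k}{l}E_{m+i-k-l}(0)=0.$$ (4) If $1\leq j\leq m$ and $0\leq k\leq m$, then $$\sum_{\substack{i=j\\ m+i~\text{even}}}^{m}\binom mi\binom{m+i}{k}\binom{m+i-k}{m+j-k}E_{i-j}(0)=(-1)^{m+j}\binom mj\binom{m+j}{k}.$$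
   Context: The Euler polynomials $E_n(a)$ are defined by $\frac{2e^{at}}{e^t+1}=\sum_{n=0}^\infty E_n(a)\frac{t^n}{n!}$; $\binom{N}{k}$ denotes the binomial coefficient. *)

theory Defs
  imports Complex_Main "HOL-Computational_Algebra.Formal_Power_Series"
begin

(* The generating function is read as a formal power series in t = fps_X over a field of
   characteristic 0.  Here fps_exp a is the series exp (a * t), and the quotient is a genuine
   one because the denominator has constant coefficient 2; see euler_poly_gf below. *)

definition euler_poly :: "nat \<Rightarrow> 'a :: field_char_0 \<Rightarrow> 'a" where
  "euler_poly n a = fact n * fps_nth (2 * fps_exp a / (fps_exp 1 + 1)) n"

lemma euler_poly_gf:
  fixes a :: "'a :: field_char_0"
  shows "Abs_fps (\<lambda>n. euler_poly n a / fact n) = 2 * fps_exp a / (fps_exp 1 + 1)"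
    and "Abs_fps (\<lambda>n. euler_poly n a / fact n) * (fps_exp 1 + 1) = 2 * fps_exp a"
proof -
  show gf: "Abs_fps (\<lambda>n. euler_poly n a / fact n) = 2 * fps_exp a / (fps_exp 1 + 1)"
    by (simp add: fps_eq_iff euler_poly_def)
  have "fps_nth (fps_exp 1 + 1 :: 'a fps) 0 \<noteq> 0"
    by simp
  then have "is_unit (fps_exp 1 + 1 :: 'a fps)"
    using fps_is_unit_iff by blast
  then show "Abs_fps (\<lambda>n. euler_poly n a / fact n) * (fps_exp 1 + 1) = 2 * fps_exp a"
    by (simp add: gf)
qed

end

theory Submission
  imports Defs "HOL-Computational_Algebra.Polynomial"
begin

text \<open>
  By the trinomial revision \<open>C(N,k) C(N-k,l) = C(N,k+l) C(k+l,k)\<close> all four identities are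
  instances of a single evaluation of \<open>\<Sum>i C(m,i) C(m+i,s) E_{m+i-s}(0)\<close> over \<open>m + i\<close> even.
  Let \<open>L\<close> be the linear functional on polynomials sending \<open>x^n\<close> to \<open>E_n(0)\<close>; the generating function says
  \<open>L (p(x+1) + p(x)) = 2 p(0)\<close>. Put \<open>p = x^m (x-1)^m\<close>, so that \<open>p(x+1) = x^m (x+1)^m = p(-x)\<close> and
  \<open>(p(x+1) + p(x))/2\<close> is the even part of \<open>x^m (x+1)^m\<close>. Applying \<open>L\<close> to the \<open>s\<close>-th divided derivative of
  this even part gives the sum on the one hand, and the coefficient of \<open>x^s\<close> in \<open>p\<close> on the other.
\<close>

text \<open>Comparison of the coefficients of \<open>t^n\<close> in
  \<open>F * (fps_exp 1 + 1) = 2\<close>, where \<open>F\<close> is the generating function at 0. In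
  umbral terms this is \<open>L ((x+1)^n + x^n) = 2 * 0^n\<close>.\<close>

lemma euler_poly_0_recurrence:
  "(\<Sum>j\<le>n. of_nat (n choose j) * euler_poly j 0) + euler_poly n 0
     = (if n = 0 then 2 else (0 :: 'a :: field_char_0))"
proof -
  define F :: "'a fps" where "F = Abs_fps (\<lambda>n. euler_poly n 0 / fact n)"
  have "F * fps_exp 1 + F = 2"
    using euler_poly_gf(2)[of "0 :: 'a"] by (simp add: F_def algebra_simps)
  then have *: "fps_nth (F * fps_exp 1) n + fps_nth F n = fps_nth 2 n"
    by (metis fps_add_nth)
  have "(\<Sum>j\<le>n. of_nat (n choose j) * euler_poly j 0) = fact n * fps_nth (F * fps_exp 1) n"
    by (auto simp: fps_mult_nth F_def sum_distrib_left binomial_fact atLeast0AtMost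
             intro!: sum.cong)
  moreover have "euler_poly n 0 = fact n * fps_nth F n"
    by (simp add: F_def)
  ultimately have "(\<Sum>j\<le>n. of_nat (n choose j) * euler_poly j 0) + euler_poly n 0
      = fact n * fps_nth (2 :: 'a fps) n"
    by (simp add: * flip: distrib_left)
  then show ?thesis
    by (simp add: fps_numeral_nth)
qed

text \<open>Classical umbral evaluation: the linear functional with moments
  \<open>w n\<close>.\<close>

definition umbral :: "(nat \<Rightarrow> 'a) \<Rightarrow> 'a poly \<Rightarrow> 'a :: comm_semiring_1" where
  "umbral w p = (\<Sum>n\<le>degree p. coeff p n * w n)"

lemma umbral_upto:
  assumes "degree p \<le> N"
  shows "umbral w p = (\<Sum>n\<le>N. coeff p n * w n)"
  unfolding umbral_def using assms
  by (intro sum.mono_neutral_left) (auto simp: coeff_eq_0)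

lemma umbral_0 [simp]: "umbral w 0 = 0"
  by (simp add: umbral_def)

lemma umbral_add: "umbral w (p + q) = umbral w p + umbral w q"
proof -
  define N where "N = max (degree p) (degree q)"
  have "degree (p + q) \<le> N" "degree p \<le> N" "degree q \<le> N"
    by (auto simp: N_def degree_add_le)
  then show ?thesis
    by (simp add: umbral_upto[of _ N] sum.distrib distrib_right)
qed

lemma umbral_sum: "umbral w (\<Sum>i\<in>A. f i) = (\<Sum>i\<in>A. umbral w (f i))"
  by (induction A rule: infinite_finite_induct) (simp_all add: umbral_add)

lemma umbral_monom: "umbral w (monom c n) = c * w n"
proof -
  have "umbral w (monom c n) = (\<Sum>i\<le>n. (if n = i then c else 0) * w i)"
    by (simp add: umbral_upto[OF degree_monom_le])
  also have "\<dots> = (\<Sum>i\<le>n. if n = i then c * w i else 0)"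
    by (intro sum.cong) auto
  finally show ?thesis
    by simp
qed

lemma pcompose_power: "pcompose (p ^ n) q = pcompose p q ^ n"
  by (induction n) (simp_all add: pcompose_mult pcompose_1)

lemma smult_sum_right: "smult c (\<Sum>i\<in>A. f i) = (\<Sum>i\<in>A. smult c (f i))"
  by (induction A rule: infinite_finite_induct) (simp_all add: smult_add_right)

lemma monom_add_one_power:
  "[:1, 1:] ^ n = (\<Sum>i\<le>n. monom (of_nat (n choose i)) i :: 'a :: comm_semiring_1 poly)"
proof -
  have "[:1, 1:] = monom (1 :: 'a) 1 + 1"
    by (simp add: monom_altdef one_pCons)
  then show ?thesis
    by (simp add: binomial_ring monom_power of_nat_monom mult_monom)
qed

lemma monom_diff_one_power:
  "[:-1, 1:] ^ n = (\<Sum>i\<le>n. monom ((-1) ^ (n - i) * of_nat (n choose i)) i :: 'a :: comm_ring_1 poly)"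
proof -
  have "[:-1, 1:] = monom (1 :: 'a) 1 + monom (-1) 0"
    by (simp add: monom_altdef one_pCons)
  then show ?thesis
    by (simp add: binomial_ring monom_power of_nat_monom mult_monom mult_ac)
qed

text \<open>The weights below turn \<open>umbral\<close> into \<open>L\<close> composed with the \<open>s\<close>-th divided derivative; the
  truncated subtraction is harmless because of the binomial factor.\<close>

definition euler_weight :: "nat \<Rightarrow> nat \<Rightarrow> 'a :: field_char_0" where
  "euler_weight s n = of_nat (n choose s) * euler_poly (n - s) 0"

text \<open>Trinomial revision pulls the factor \<open>n choose s\<close> out of the sum, and the
  shift \<open>j = i + s\<close> leaves the recurrence for the Euler values at \<open>n - s\<close>.
  That vanishes unless \<open>n = s\<close>, where the factor is 1.\<close>

lemma euler_weight_recurrence: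
  "(\<Sum>j\<le>n. of_nat (n choose j) * euler_weight s j) + euler_weight s n
     = (if n = s then 2 else (0 :: 'a :: field_char_0))"
proof (cases "s \<le> n")
  case False
  then show ?thesis
    by (auto simp: euler_weight_def binomial_eq_0 intro!: sum.neutral)
next
  case True
  have "(\<Sum>j\<le>n. of_nat (n choose j) * euler_weight s j)
      = (\<Sum>j\<in>{s..n}. of_nat (n choose j) * euler_weight s j :: 'a)"
    by (intro sum.mono_neutral_right) (auto simp: euler_weight_def)
  also have "\<dots> = (\<Sum>j\<in>{s..n}. of_nat (n choose s) * (of_nat ((n - s) choose (j - s)) * euler_poly (j - s) 0))"
  proof (rule sum.cong)
    fix j assume "j \<in> {s..n}"
    then have "(n choose j) * (j choose s) = (n choose s) * ((n - s) choose (j - s))"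
      by (intro choose_mult) auto
    then have "of_nat (n choose j) * of_nat (j choose s)
        = (of_nat (n choose s) * of_nat ((n - s) choose (j - s)) :: 'a)"
      by (metis of_nat_mult)
    then show "of_nat (n choose j) * euler_weight s j
        = of_nat (n choose s) * (of_nat ((n - s) choose (j - s)) * euler_poly (j - s) (0 :: 'a))"
      by (simp add: euler_weight_def flip: mult.assoc)
  qed simp
  also have "\<dots> = of_nat (n choose s) * (\<Sum>j\<in>{s..n}. of_nat ((n - s) choose (j - s)) * euler_poly (j - s) 0)"
    by (simp add: sum_distrib_left)
  also have "(\<Sum>j\<in>{s..n}. of_nat ((n - s) choose (j - s)) * euler_poly (j - s) (0 :: 'a))
      = (\<Sum>i\<le>n - s. of_nat ((n - s) choose i) * euler_poly i 0)"
    by (rule sum.reindex_bij_witness[of _ "\<lambda>i. i + s" "\<lambda>j. j - s"]) (use True in auto)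
  finally have "(\<Sum>j\<le>n. of_nat (n choose j) * euler_weight s j) + euler_weight s n
      = (of_nat (n choose s) :: 'a) *
          ((\<Sum>i\<le>n - s. of_nat ((n - s) choose i) * euler_poly i 0) + euler_poly (n - s) 0)"
    by (simp add: euler_weight_def distrib_left)
  then show ?thesis
    using True by (simp add: euler_poly_0_recurrence)
qed

text \<open>Both sides are linear in \<open>p\<close>, so monomials suffice. For \<open>x^n\<close>
  the binomial expansion of \<open>(x+1)^n\<close> turns the left side into the weight recurrence,
  whose condition \<open>n = s\<close> is what selects the coefficient at \<open>s\<close>.\<close>

lemma umbral_euler_weight_shift:
  fixes p :: "'a :: field_char_0 poly"
  shows "umbral (euler_weight s) (pcompose p [:1, 1:]) + umbral (euler_weight s) p = 2 * coeff p s"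
proof -
  define L :: "'a poly \<Rightarrow> 'a" where "L = umbral (euler_weight s)"
  have monom: "L (pcompose (monom c n) [:1, 1:]) + L (monom c n) = 2 * coeff (monom c n) s" for c n
  proof -
    have "pcompose (monom c n) [:1, 1:] = (\<Sum>i\<le>n. monom (c * of_nat (n choose i)) i)"
      by (simp add: monom_altdef pcompose_smult pcompose_pCons pcompose_power monom_add_one_power
          smult_sum_right smult_monom)
    then have "L (pcompose (monom c n) [:1, 1:]) + L (monom c n)
        = c * ((\<Sum>j\<le>n. of_nat (n choose j) * euler_weight s j) + euler_weight s n)"
      by (simp add: L_def umbral_sum umbral_monom sum_distrib_left distrib_left mult_ac)
    then show ?thesis
      by (simp add: euler_weight_recurrence)
  qed
  have p: "p = (\<Sum>n\<le>degree p. monom (coeff p n) n)"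
    by (simp add: poly_as_sum_of_monoms)
  have "L (pcompose p [:1, 1:]) + L p
      = (\<Sum>n\<le>degree p. L (pcompose (monom (coeff p n) n) [:1, 1:]) + L (monom (coeff p n) n))"
    by (subst (1 2) p) (simp add: L_def pcompose_sum umbral_sum sum.distrib)
  also have "\<dots> = 2 * coeff (\<Sum>n\<le>degree p. monom (coeff p n) n) s"
    by (simp only: monom coeff_sum sum_distrib_left)
  finally show ?thesis
    by (simp add: L_def poly_as_sum_of_monoms)
qed

lemma sum_even_euler_weight:
  fixes m s :: nat
  shows "(\<Sum>i\<in>{i\<in>{0..m}. even (m + i)}. of_nat (m choose i) * euler_weight s (m + i))
    = (if m \<le> s then (-1) ^ s * of_nat (m choose (s - m)) else (0 :: 'a :: field_char_0))"
proof -
  define p :: "'a poly" where "p = monom 1 m * [:-1, 1:] ^ m"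
  have p: "p = (\<Sum>i\<le>m. monom ((-1) ^ (m - i) * of_nat (m choose i)) (m + i))"
    by (simp add: p_def monom_diff_one_power sum_distrib_left mult_monom)
  have "pcompose p [:1, 1:] = monom 1 m * [:1, 1:] ^ m"
    by (simp add: p_def monom_altdef pcompose_mult pcompose_pCons mult.commute
        pcompose_power)
  then have shift: "pcompose p [:1, 1:] = (\<Sum>i\<le>m. monom (of_nat (m choose i)) (m + i))"
    by (simp add: monom_add_one_power sum_distrib_left mult_monom)
  have "2 * (\<Sum>i\<in>{i\<in>{0..m}. even (m + i)}. of_nat (m choose i) * euler_weight s (m + i) :: 'a)
      = (\<Sum>i\<in>{0..m}. if even (m + i) then 2 * (of_nat (m choose i) * euler_weight s (m + i)) else 0)"
    by (subst sum.inter_filter[symmetric]) (simp_all add: sum_distrib_left)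
  \<comment> \<open>The parity filter becomes the factor \<open>1 + (-1)^(m - i)\<close>, because
    \<open>m - i\<close> and \<open>m + i\<close> have the same parity. The two resulting sums are
    the functional at the shifted \<open>p\<close> and at \<open>p\<close>.\<close>
  also have "\<dots> = (\<Sum>i\<le>m. of_nat (m choose i) * euler_weight s (m + i)
      + (-1) ^ (m - i) * of_nat (m choose i) * euler_weight s (m + i))"
    by (intro sum.cong) (auto simp: uminus_power_if even_diff_nat)
  also have "\<dots> = 2 * coeff p s"
    using umbral_euler_weight_shift[of s p]
    by (subst (asm) shift, subst (asm) p) (simp add: umbral_sum umbral_monom sum.distrib)
  finally have "(\<Sum>i\<in>{i\<in>{0..m}. even (m + i)}. of_nat (m choose i) * euler_weight s (m + i)) = coeff p s"
    by simp
  also have "\<dots> = (if m \<le> s then coeff ([:-1, 1:] ^ m) (s - m) else 0)"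
    by (simp add: p_def coeff_monom_mult)
  also have "coeff ([:-1, 1:] ^ m) (s - m) = (-1) ^ (m - (s - m)) * (of_nat (m choose (s - m)) :: 'a)"
    by (cases "s - m \<le> m") (simp_all add: monom_diff_one_power coeff_sum binomial_eq_0)
  \<comment> \<open>For \<open>m \<le> s \<le> 2 * m\<close> the exponent is
    \<open>2 * m - s\<close>, which has the parity of \<open>s\<close>. For larger \<open>s\<close>
    the subtraction truncates, but the binomial coefficient is zero.\<close>
  also have "(if m \<le> s then \<dots> else 0)
      = (if m \<le> s then (-1) ^ s * of_nat (m choose (s - m)) else 0)"
    by (cases "s - m \<le> m") (auto simp: uminus_power_if binomial_eq_0 even_diff_nat)
  finally show ?thesis .
qed

text \<open>Trinomial revision reduces the summand to a constant times the weight for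
  \<open>s = k + l\<close>. The index set \<open>A\<close> is left flexible so that sums starting at
  \<open>i = j\<close> are covered too.\<close>

lemma sum_even_choose_choose_euler_poly:
  fixes m k l :: nat
  assumes "A \<subseteq> {0..m}" and "\<And>i. i \<le> m \<Longrightarrow> i \<notin> A \<Longrightarrow> m + i < k + l"
    and "k \<le> m"
  shows "(\<Sum>i\<in>{i\<in>A. even (m + i)}.
      of_nat (m choose i) * of_nat ((m + i) choose k) * of_nat ((m + i - k) choose l)
        * euler_poly (m + i - k - l) 0)
    = (if m \<le> k + l
       then (-1) ^ (k + l) * of_nat (m choose (k + l - m)) * of_nat ((k + l) choose k)
       else (0 :: 'a :: field_char_0))"
proof -
  have "of_nat ((m + i) choose k) * of_nat ((m + i - k) choose l) * euler_poly (m + i - k - l) 0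
      = of_nat ((k + l) choose k) * (euler_weight (k + l) (m + i) :: 'a)" for i
  proof (cases "k + l \<le> m + i")
    case True
    then have "((m + i) choose (k + l)) * ((k + l) choose k) = ((m + i) choose k) * ((m + i - k) choose l)"
      using choose_mult[of k "k + l" "m + i"] by simp
    then have "of_nat ((m + i) choose k) * of_nat ((m + i - k) choose l)
        = (of_nat ((m + i) choose (k + l)) * of_nat ((k + l) choose k) :: 'a)"
      by (metis of_nat_mult)
    then show ?thesis
      by (simp add: euler_weight_def)
  next
    \<comment> \<open>Here \<open>m + i - k < l\<close>, so the second binomial on the left
      vanishes, as does the weight on the right.\<close>
    case False
    then show ?thesis
      using assms(3) by (simp add: euler_weight_def binomial_eq_0)
  qed
  then have "(\<Sum>i\<in>{i\<in>A. even (m + i)}.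
      of_nat (m choose i) * of_nat ((m + i) choose k) * of_nat ((m + i - k) choose l)
        * euler_poly (m + i - k - l) 0)
      = (\<Sum>i\<in>{i\<in>A. even (m + i)}.
          of_nat ((k + l) choose k) * (of_nat (m choose i) * euler_weight (k + l) (m + i)) :: 'a)"
    by (intro sum.cong) (simp_all add: mult_ac)
  also have "\<dots> = (\<Sum>i\<in>{i\<in>{0..m}. even (m + i)}.
          of_nat ((k + l) choose k) * (of_nat (m choose i) * euler_weight (k + l) (m + i)))"
    \<comment> \<open>The added indices satisfy \<open>m + i < k + l\<close>, so their weights are
      zero.\<close>
    using assms(1,2) by (intro sum.mono_neutral_left) (auto simp: euler_weight_def)
  also have "\<dots> = of_nat ((k + l) choose k) * (if m \<le> k + l
       then (-1) ^ (k + l) * of_nat (m choose (k + l - m)) else 0)"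
    by (simp only: sum_even_euler_weight flip: sum_distrib_left)
  finally show ?thesis
    by simp
qed

theorem theorem1p13:
  fixes m k :: nat
  shows
    "(k \<le> m \<longrightarrow>
        (\<Sum>i\<in>{i\<in>{0..m}. even (m + i)}.
           real (m choose i) * real ((m + i) choose k) * real ((m + i - k) choose (m - k))
             * euler_poly i 0)
        = (-1) ^ m * real (m choose k))
   \<and> (k + 1 \<le> m \<longrightarrow>
        (\<Sum>i\<in>{i\<in>{0..m}. even (m + i)}.
           real (m choose i) * real ((m + i) choose k) * real ((m + i - k) choose (m - k - 1))
             * euler_poly (i + 1) 0)
        = 0)
   \<and> (\<forall>l::nat. k + l + 1 \<le> m \<longrightarrow>
        (\<Sum>i\<in>{i\<in>{0..m}. even (m + i)}.
           real (m choose i) * real ((m + i) choose k) * real ((m + i - k) choose l)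
             * euler_poly (m + i - k - l) 0)
        = 0)
   \<and> (\<forall>j::nat. 1 \<le> j \<and> j \<le> m \<and> k \<le> m \<longrightarrow>
        (\<Sum>i\<in>{i\<in>{j..m}. even (m + i)}.
           real (m choose i) * real ((m + i) choose k) * real ((m + i - k) choose (m + j - k))
             * euler_poly (i - j) 0)
        = (-1) ^ (m + j) * real (m choose j) * real ((m + j) choose k))"
proof (intro conjI impI allI)
  let ?S = "\<lambda>A l. \<Sum>i\<in>{i\<in>A. even (m + i)}.
      real (m choose i) * real ((m + i) choose k) * real ((m + i - k) choose l)
        * euler_poly (m + i - k - l) 0"
  {
    assume k: "k \<le> m"
    \<comment> \<open>The boundary case \<open>k + l = m\<close>: the factor
      \<open>m choose (k + l - m)\<close> is 1.\<close>
    have "?S {0..m} (m - k) = (-1) ^ m * real (m choose k)"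
      using sum_even_choose_choose_euler_poly[of "{0..m}" m k "m - k", where 'a = real] k by simp
    with k show "(\<Sum>i\<in>{i\<in>{0..m}. even (m + i)}.
        real (m choose i) * real ((m + i) choose k) * real ((m + i - k) choose (m - k))
          * euler_poly i 0) = (-1) ^ m * real (m choose k)"
      by simp
  }
  {
    assume k: "k + 1 \<le> m"
    \<comment> \<open>Now \<open>k + l = m - 1\<close>, just below the order \<open>m\<close> to
      which \<open>x\<close> divides \<open>x^m (x-1)^m\<close>, so the coefficient is zero.\<close>
    then have "\<not> m \<le> k + (m - k - 1)"
      by linarith
    then have "?S {0..m} (m - k - 1) = 0"
      using k by (subst sum_even_choose_choose_euler_poly) (simp_all only:, auto)
    moreover have "m + i - k - (m - k - 1) = i + 1" for i
      using k by simp
    ultimately show "(\<Sum>i\<in>{i\<in>{0..m}. even (m + i)}.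
        real (m choose i) * real ((m + i) choose k) * real ((m + i - k) choose (m - k - 1))
          * euler_poly (i + 1) 0) = 0"
      by simp
  }
  {
    fix l assume "k + l + 1 \<le> m"
    then show "?S {0..m} l = 0"
      using sum_even_choose_choose_euler_poly[of "{0..m}" m k l, where 'a = real] by simp
  }
  {
    fix j assume j: "1 \<le> j \<and> j \<le> m \<and> k \<le> m"
    \<comment> \<open>With \<open>k + l = m + j\<close>, every omitted index \<open>i < j\<close>
      has \<open>m + i < k + l\<close>, as the general evaluation demands.\<close>
    have "?S {j..m} (m + j - k) = (-1) ^ (m + j) * real (m choose j) * real ((m + j) choose k)"
      using sum_even_choose_choose_euler_poly[of "{j..m}" m k "m + j - k", where 'a = real] j
      by simp
    moreover have "m + i - k - (m + j - k) = i - j" for i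
      using j by simp
    ultimately show "(\<Sum>i\<in>{i\<in>{j..m}. even (m + i)}.
        real (m choose i) * real ((m + i) choose k) * real ((m + i - k) choose (m + j - k))
          * euler_poly (i - j) 0) = (-1) ^ (m + j) * real (m choose j) * real ((m + j) choose k)"
      by simp
  }
qed

end
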